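(* Let $a\ge1$ be an integer. For complex $X$ with $|X|<1$, \begin{align*} &2\sum_{b=2}^{\infty}\sum_{k=1}^{b-1}\frac{(1-2^{b-k})B_{b-k}}{(b-k)!}(-\pi i)^{b-k-1}\,T(\{1\}^{a-1},k+1)\,X^b\\ &=\frac{i^{a}}{(a-1)!}X\sec\Big(\frac{\pi X}{2}\Big)\int_0^{\pi/2}\theta^{a-1}e^{-X\log\tan(\theta/2)}\,d\theta -\frac{i}{a!}\int_0^{\pi/2}\frac{2X^2e^{-i\theta X}}{e^{-\pi iX}+1}\Big(\frac{\pi}{2}i-\log\tan\frac{\theta}{2}\Big)^{a}d\theta\\ &\quad-\frac{(i\pi/2)^a}{a!}X\sec\Big(\frac{\pi X}{2}\Big), \end{align*} where $B_k$ denotes the $k$-th Bernoulli number.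
   Context: $\{1\}^{m}$ denotes $m$ repetitions of $1$. Multiple $T$-values: for $\mathbf{k}=(k_1,\dots,k_n)\in\mathbb{Z}_{\ge1}^n$ with $k_n\ge2$, $T(\mathbf{k})=2^n\sum_{0<m_1<\cdots<m_n,\ m_j\equiv j \bmod 2} m_1^{-k_1}\cdots m_n^{-k_n}$. Bernoulli numbers: $X/(e^X-1)=\sum_{k\ge0}B_kX^k/k!$. *)

theory Defs
  imports "HOL-Analysis.Analysis" "HOL-Computational_Algebra.Formal_Power_Series"
    "HOL-Number_Theory.Cong"
begin

text \<open>
  The convention is the one with \<open>B\<^sub>1 = -1/2\<close>: the numbers are read off the formal power series
  of \<open>X / (e\<^sup>X - 1)\<close>.
\<close>

definition bernoulli :: "nat \<Rightarrow> real" where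
  "bernoulli k = fact k * fps_nth (fps_X / (fps_exp 1 - 1)) k"

lemma bernoulli_generating_function:
  "Abs_fps (\<lambda>k. bernoulli k / fact k) * (fps_exp 1 - 1) = fps_X"
proof -
  have nth1: "fps_nth (fps_exp 1 - 1 :: real fps) (Suc 0) = 1"
    by simp
  hence nz: "fps_exp 1 - 1 \<noteq> (0 :: real fps)"
    by (metis fps_zero_nth zero_neq_one)
  have "subdegree (fps_exp 1 - 1 :: real fps) = 1"
    by (rule subdegreeI) auto
  hence "(fps_exp 1 - 1 :: real fps) dvd fps_X"
    by (subst fps_dvd_iff) (use nz in auto)
  hence "fps_X / (fps_exp 1 - 1) * (fps_exp 1 - 1) = (fps_X :: real fps)"
    by simp
  moreover have "Abs_fps (\<lambda>k. bernoulli k / fact k) = fps_X / (fps_exp 1 - 1)"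
    by (rule fps_ext) (simp add: bernoulli_def)
  ultimately show ?thesis
    by simp
qed

text \<open>
  A summation tuple \<open>(m\<^sub>1, \<dots>, m\<^sub>n)\<close> is a list, whose entry \<open>m\<^sub>j\<close> has position \<open>j - 1\<close>; this
  accounts for the shift in the parity condition.
\<close>

definition T_indices :: "nat \<Rightarrow> nat list set" where
  "T_indices n = {ms. length ms = n \<and> sorted_wrt (<) ms \<and>
     (\<forall>j<n. 0 < ms ! j \<and> [ms ! j = j + 1] (mod 2))}"

text \<open>
  The argument is \<open>[k\<^sub>1, \<dots>, k\<^sub>n]\<close>. Only lists of positive entries whose last entry is
  at least 2 are meaningful; the value elsewhere is immaterial.
\<close>

definition T_value :: "nat list \<Rightarrow> real" where
  "T_value ks = 2 ^ length ks *
     (\<Sum>\<^sub>\<infinity>ms\<in>T_indices (length ks). \<Prod>j<length ks. 1 / real (ms ! j) ^ (ks ! j))"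

definition sec :: "complex \<Rightarrow> complex" where
  "sec z = 1 / cos z"

end

theory Submission
  imports Defs "HOL-Complex_Analysis.Complex_Analysis"
begin

text \<open>
  Let \<open>c\<^sub>n\<close> be the Taylor coefficients of \<open>Ln ((1 + t) / (1 - t)) ^ a / fact a\<close>. Grouping the
  summation tuples by their last entry gives \<open>T({1}\<^sup>a\<^sup>-\<^sup>1, k + 1) = (\<Sum>n. c\<^sub>n / n ^ k)\<close>, so the
  generating function in \<open>k\<close> is \<open>X * (\<Sum>n. c\<^sub>n / (n - X))\<close>. Together with the Bernoulli series of
  \<open>w / (exp w + 1)\<close>, where \<open>w = - pi * \<i> * X\<close>, the left-hand side becomes
  \<open>2 * X\<^sup>2 / (exp w + 1) * H(1)\<close> with \<open>H(t) = (\<Sum>n. c\<^sub>n / (n - X) * t ^ n)\<close>.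

  The function \<open>t powr (- X) * H(t)\<close> is a primitive of
  \<open>t powr (- X - 1) * Ln ((1 + t) / (1 - t)) ^ a / fact a\<close>, and \<open>H\<close> is continuous on the closed unit
  disc. Hence \<open>H(1)\<close> is obtained from \<open>H(\<i>)\<close> by integrating along the quarter circle from \<open>1\<close> to
  \<open>\<i>\<close>, where \<open>Ln ((1 + t) / (1 - t)) = \<i> * pi / 2 - ln (tan (\<theta> / 2))\<close> at \<open>t = cis \<theta>\<close>, and \<open>H(\<i>)\<close> by
  integrating along the segment from \<open>0\<close> to \<open>\<i>\<close>, where \<open>Ln ((1 + t) / (1 - t)) = \<i> * \<theta>\<close> at
  \<open>t = \<i> * tan (\<theta> / 2)\<close>.
\<close>

section \<open>Taylor series of powers of the logarithm\<close>

text \<open>The Cayley map carries the unit disc to the right half plane, so the principal logarithm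
  stays off its cut there.\<close>

lemma Re_cayley_pos:
  assumes "norm (t :: complex) < 1"
  shows "Re ((1 + t) / (1 - t)) > 0"
proof -
  have "t \<noteq> 1" using assms by auto
  hence "(1 - Re t)\<^sup>2 + (Im t)\<^sup>2 > 0"
    by (metis complex_eq_0 one_complex.sel right_minus_eq minus_complex.sel sum_power2_gt_zero_iff diff_0)
  moreover have "(Re t)\<^sup>2 + (Im t)\<^sup>2 < 1"
    using assms by (simp add: cmod_def)
  ultimately show ?thesis
    by (simp add: Re_divide divide_pos_pos power2_eq_square algebra_simps)
qed

text \<open>The Cayley map also preserves the upper half plane. This keeps the logarithm holomorphic
  across the open upper unit semicircle, where the disc argument stops.\<close>

lemma Im_cayley_pos:
  assumes "Im t > 0"
  shows "Im ((1 + t) / (1 - t)) > 0"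
proof -
  have "(1 - Re t)\<^sup>2 + (Im t)\<^sup>2 > 0"
    using assms by (simp add: sum_power2_gt_zero_iff)
  moreover have "Im t * (1 - Re t) + (1 + Re t) * Im t > 0"
    using assms by (simp add: algebra_simps)
  ultimately show ?thesis
    by (simp add: Im_divide divide_pos_pos)
qed

lemma has_field_derivative_Ln_cayley:
  assumes "(1 + t) / (1 - t) \<notin> \<real>\<^sub>\<le>\<^sub>0" "t \<noteq> 1"
  shows "((\<lambda>t. Ln ((1 + t) / (1 - t))) has_field_derivative 2 / (1 - t\<^sup>2)) (at t)"
proof -
  have nz: "1 + t \<noteq> 0" "1 - t \<noteq> 0"
    using assms by (auto simp: complex_nonpos_Reals_iff)
  hence "1 - t\<^sup>2 \<noteq> 0"
    by (metis mult_eq_0_iff one_power2 square_diff_square_factored power2_eq_square)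
  hence "inverse ((1 + t) / (1 - t)) * ((1 * (1 - t) - (1 + t) * (-1)) / ((1 - t) * (1 - t))) = 2 / (1 - t\<^sup>2)"
    using nz by (simp add: divide_simps) (simp add: power2_eq_square algebra_simps)
  thus ?thesis
    using assms nz by (auto intro!: derivative_eq_intros simp: divide_simps)
qed

text \<open>The recurrence is coefficient extraction from the derivative
  \<open>2 / (1 - t\<^sup>2) * Ln ((1 + t) / (1 - t)) ^ a / fact a\<close> of the next normalised
  power, and equally the removal of the largest entry of a summation tuple. At \<open>n = 0\<close>
  division by zero gives the correct value 0.\<close>

primrec T_coeff :: "nat \<Rightarrow> nat \<Rightarrow> real" where
  "T_coeff 0 n = (if n = 0 then 1 else 0)"
| "T_coeff (Suc a) n = 2 / real n * (\<Sum>m | m < n \<and> odd (n - m). T_coeff a m)"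

lemma T_coeff_nonneg: "T_coeff a n \<ge> 0"
  by (induction a arbitrary: n) (auto intro!: mult_nonneg_nonneg divide_nonneg_nonneg sum_nonneg simp del: even_diff_nat)

text \<open>Each level of the recurrence flips the parity, starting from the index 0. This later
  replaces the congruences in \<open>T_indices\<close>.\<close>

lemma T_coeff_parity: "T_coeff a n \<noteq> 0 \<Longrightarrow> even (a + n)"
proof (induction a arbitrary: n)
  case (Suc a)
  then obtain m where "m < n" "odd (n - m)" "T_coeff a m \<noteq> 0"
    by (auto elim: sum.not_neutral_contains_not_neutral)
  with Suc.IH[of m] show ?case
    by auto
qed (auto split: if_splits)

lemma T_coeff_0_right [simp]: "a > 0 \<Longrightarrow> T_coeff a 0 = 0"
  by (cases a) auto

text \<open>Telescoping, since \<open>1 / sqrt (n + 1)\<close> is at most twice the increment of the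
  square root.\<close>

lemma sum_inverse_sqrt_le: "(\<Sum>m=1..n. 1 / sqrt (real m)) \<le> 2 * sqrt (real n)"
proof (induction n)
  case (Suc n)
  have pos: "sqrt (real (Suc n)) + sqrt (real n) > 0"
    by (simp add: add_pos_nonneg)
  have "(sqrt (real (Suc n)) - sqrt (real n)) * (sqrt (real (Suc n)) + sqrt (real n)) = 1"
    by (simp add: algebra_simps)
  hence "2 * (sqrt (real (Suc n)) - sqrt (real n)) = 2 / (sqrt (real (Suc n)) + sqrt (real n))"
    using pos by (simp add: field_simps)
  also have "\<dots> \<ge> 2 / (2 * sqrt (real (Suc n)))"
    using pos by (intro divide_left_mono) auto
  finally show ?case
    using Suc by simp
qed auto

lemma T_coeff_Suc_le_sum: "T_coeff (Suc a) n \<le> 2 / real n * (\<Sum>m<n. T_coeff a m)"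
  unfolding T_coeff.simps
  by (intro mult_left_mono sum_mono2) (auto simp: T_coeff_nonneg)

text \<open>The true growth is polylogarithmic, but a square root bound reproduces itself under the
  recurrence and still makes \<open>T_coeff a n / n\<close> summable.\<close>

lemma sum_T_coeff_le: "(\<Sum>m<n. T_coeff a m) \<le> 4 ^ a * sqrt (real n)"
proof (induction a arbitrary: n)
  case 0
  show ?case by (cases n) (auto simp: sum.If_cases)
next
  case (Suc a)
  have le: "T_coeff (Suc a) m \<le> 2 * 4 ^ a * (1 / sqrt (real m))" for m
  proof -
    have "T_coeff (Suc a) m \<le> 2 / real m * (4 ^ a * sqrt (real m))"
      by (rule order.trans[OF T_coeff_Suc_le_sum mult_left_mono[OF Suc]]) auto
    also have "\<dots> = 2 * 4 ^ a * (sqrt (real m) / real m)"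
      by simp
    also have "sqrt (real m) / real m = 1 / sqrt (real m)"
      by (simp add: sqrt_divide_self_eq inverse_eq_divide)
    finally show ?thesis .
  qed
  have "(\<Sum>m<n. T_coeff (Suc a) m) \<le> (\<Sum>m<n. 2 * 4 ^ a * (1 / sqrt (real m)))"
    by (intro sum_mono le)
  also have "\<dots> = (\<Sum>m\<in>{1..<n}. 2 * 4 ^ a * (1 / sqrt (real m)))"
    by (intro sum.mono_neutral_right) (auto simp: Suc_le_eq)
  also have "\<dots> \<le> (\<Sum>m=1..n. 2 * 4 ^ a * (1 / sqrt (real m)))"
    by (intro sum_mono2) auto
  also have "\<dots> \<le> 2 * 4 ^ a * (2 * sqrt (real n))"
    unfolding sum_distrib_left [symmetric] by (intro mult_left_mono sum_inverse_sqrt_le) auto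
  finally show ?case
    by simp
qed

lemma T_coeff_Suc_le: "T_coeff (Suc a) n \<le> 2 * 4 ^ a / sqrt (real n)"
proof -
  have "T_coeff (Suc a) n \<le> 2 / real n * (4 ^ a * sqrt (real n))"
    by (rule order.trans[OF T_coeff_Suc_le_sum mult_left_mono[OF sum_T_coeff_le]]) auto
  also have "\<dots> = 2 * 4 ^ a * (sqrt (real n) / real n)"
    by simp
  also have "sqrt (real n) / real n = 1 / sqrt (real n)"
    by (simp add: sqrt_divide_self_eq inverse_eq_divide)
  finally show ?thesis
    by simp
qed

lemma summable_T_coeff_div:
  assumes "a > 0"
  shows "summable (\<lambda>n. T_coeff a n / real n)"
proof -
  obtain d where a: "a = Suc d"
    using assms by (cases a) auto
  \<comment> \<open>The coefficients decay like \<open>n powr (-1/2)\<close>, and the division by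
    \<open>n\<close> adds one to the exponent.\<close>
  have "summable (\<lambda>n. 2 * 4 ^ d * real n powr (-3/2))"
    by (intro summable_mult) (simp add: summable_real_powr_iff)
  thus ?thesis
  proof (rule summable_comparison_test')
    fix n :: nat
    have "T_coeff a n / real n \<le> 2 * 4 ^ d / sqrt (real n) / real n"
      unfolding a by (intro divide_right_mono T_coeff_Suc_le) auto
    also have "\<dots> = 2 * 4 ^ d * real n powr (-3/2)"
    proof (cases "n = 0")
      case False
      have "real n powr (-3/2) = real n powr (-1/2 + (-1))"
        by simp
      also have "\<dots> = real n powr (-1/2) * real n powr (-1)"
        by (rule powr_add)
      also have "\<dots> = 1 / sqrt (real n) / real n"
        using False by (simp add: powr_minus powr_half_sqrt field_simps)
      finally show ?thesis by simp
    qed auto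
    finally show "norm (T_coeff a n / real n) \<le> 2 * 4 ^ d * real n powr (-3/2)"
      by (simp add: T_coeff_nonneg)
  qed
qed

section \<open>The formal power series of the coefficients and its sum\<close>

definition T_fps :: "nat \<Rightarrow> complex fps" where
  "T_fps a = Abs_fps (\<lambda>n. of_real (T_coeff a n))"

lemma T_fps_nth [simp]: "fps_nth (T_fps a) n = of_real (T_coeff a n)"
  by (simp add: T_fps_def)

lemma T_coeff_le: "T_coeff a n \<le> 4 ^ a"
proof (cases a)
  case (Suc d)
  have "T_coeff a n \<le> 2 * 4 ^ d / sqrt (real n)"
    unfolding Suc by (rule T_coeff_Suc_le)
  also have "\<dots> \<le> 2 * 4 ^ d"
    by (cases "n = 0") (auto simp: field_simps)
  also have "\<dots> \<le> 4 ^ a"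
    by (simp add: Suc)
  finally show ?thesis .
qed auto

lemma conv_radius_T_fps: "fps_conv_radius (T_fps a) \<ge> 1"
  unfolding fps_conv_radius_def
proof (rule conv_radius_geI_ex')
  fix r :: real
  assume r: "0 < r" "ereal r < 1"
  have "summable (\<lambda>n. 4 ^ a * r ^ n)"
    using r by (intro summable_mult summable_geometric) auto
  thus "summable (\<lambda>n. fps_nth (T_fps a) n * of_real r ^ n)"
    by (rule summable_comparison_test') 
      (use r in \<open>auto simp: norm_mult norm_power T_coeff_nonneg intro!: mult_right_mono T_coeff_le\<close>)
qed

text \<open>A formal differential equation: division by \<open>1 - fps_X ^ 2\<close> sums every
  second coefficient, just as the recurrence does.\<close>

lemma fps_deriv_T_fps: "fps_deriv (T_fps (Suc a)) * (1 - fps_X ^ 2) = 2 * T_fps a"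
proof (rule fps_ext)
  fix n :: nat
  \<comment> \<open>These are the coefficients of \<open>T_fps a / (1 - fps_X ^ 2)\<close>.\<close>
  define h where "h = (\<lambda>n. \<Sum>m | m \<le> n \<and> even (n - m). T_coeff a m)"
  have D: "fps_nth (fps_deriv (T_fps (Suc a))) n = 2 * of_real (h n)" for n
  proof -
    have "{m. m < n + 1 \<and> odd (n + 1 - m)} = {m. m \<le> n \<and> even (n - m)}"
      by (auto simp: Suc_diff_le less_Suc_eq_le)
    hence "real (n + 1) * T_coeff (Suc a) (n + 1) = 2 * h n"
      by (simp add: h_def del: even_diff_nat)
    hence "of_real (real (n + 1) * T_coeff (Suc a) (n + 1)) = (of_real (2 * h n) :: complex)"
      by (simp only:)
    thus ?thesis
      by (simp del: T_coeff.simps)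
  qed
  \<comment> \<open>Multiplication by \<open>1 - fps_X ^ 2\<close> takes differences at distance
    two, and only the term \<open>m = n\<close> survives.\<close>
  have h_rec: "h n - (if n < 2 then 0 else h (n - 2)) = T_coeff a n"
  proof (cases "n < 2")
    case True
    hence "{m. m \<le> n \<and> even (n - m)} = {n}"
      by (auto simp: less_2_cases_iff le_Suc_eq)
    with True show ?thesis
      by (simp add: h_def)
  next
    case False
    have "{m. m \<le> n \<and> even (n - m)} = insert n {m. m \<le> n - 2 \<and> even (n - 2 - m)}"
      using False by (auto simp: not_less) (presburger+)
    moreover have "n \<notin> {m. m \<le> n - 2 \<and> even (n - 2 - m)}"
      using False by auto
    ultimately show ?thesis
      using False by (simp add: h_def del: even_diff_nat)
  qed
  have "fps_nth (fps_deriv (T_fps (Suc a)) * (1 - fps_X ^ 2)) n =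
        2 * of_real (h n - (if n < 2 then 0 else h (n - 2)))"
    by (simp add: right_diff_distrib fps_X_power_mult_right_nth D del: fps_deriv_nth)
  thus "fps_nth (fps_deriv (T_fps (Suc a)) * (1 - fps_X ^ 2)) n = fps_nth (2 * T_fps a) n"
    by (simp add: h_rec numeral_fps_const)
qed

text \<open>By induction, both sides have the same derivative on the disc and both vanish at 0 for a
  positive exponent.\<close>

lemma eval_T_fps:
  assumes "norm t < 1"
  shows "eval_fps (T_fps a) t = Ln ((1 + t) / (1 - t)) ^ a / fact a"
  using assms
proof (induction a arbitrary: t)
  case 0
  have "T_fps 0 = 1"
    by (rule fps_ext) simp
  thus ?case
    by simp
next
  case (Suc a)
  define D where "D = (\<lambda>t. eval_fps (T_fps (Suc a)) t - Ln ((1 + t) / (1 - t)) ^ Suc a / fact (Suc a))"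
  have "(D has_field_derivative 0) (at t within ball 0 1)" if t: "t \<in> ball 0 1" for t
  proof -
    have t': "norm t < fps_conv_radius (T_fps b)" for b
      by (rule less_le_trans[OF _ conv_radius_T_fps]) (use t in auto)
    have "norm (t\<^sup>2) < 1"
      using t by (simp add: norm_power power_less_one_iff)
    hence nz: "1 - t\<^sup>2 \<noteq> 0"
      by auto
    have "eval_fps (fps_deriv (T_fps (Suc a))) t * (1 - t\<^sup>2) = 
            eval_fps (fps_deriv (T_fps (Suc a)) * (1 - fps_X ^ 2)) t"
      by (subst eval_fps_mult)
        (use t'[of "Suc a"] in \<open>auto simp: eval_fps_diff intro: less_le_trans[OF _ fps_conv_radius_deriv]
           less_le_trans[OF _ fps_conv_radius_diff]\<close>)
    also have "\<dots> = eval_fps (2 * T_fps a) t"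
      by (simp only: fps_deriv_T_fps)
    also have "\<dots> = 2 * eval_fps (T_fps a) t"
      by (subst eval_fps_mult) (use t'[of a] in auto)
    finally have deriv: "eval_fps (fps_deriv (T_fps (Suc a))) t =
        2 * (Ln ((1 + t) / (1 - t)) ^ a / fact a) / (1 - t\<^sup>2)"
      using nz t by (simp add: Suc.IH field_simps)
    have "Re ((1 + t) / (1 - t)) > 0"
      using t by (intro Re_cayley_pos) auto
    hence "(1 + t) / (1 - t) \<notin> \<real>\<^sub>\<le>\<^sub>0" "t \<noteq> 1"
      using t by (auto simp: complex_nonpos_Reals_iff)
    note [derivative_intros] = has_field_derivative_Ln_cayley[OF this]
    have "(D has_field_derivative (eval_fps (fps_deriv (T_fps (Suc a))) t - 
            of_nat (Suc a) * Ln ((1 + t) / (1 - t)) ^ a * (2 / (1 - t\<^sup>2)) / fact (Suc a))) (at t)"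
      unfolding D_def using t'[of "Suc a"]
      by (auto intro!: derivative_eq_intros has_field_derivative_eval_fps simp del: power_Suc fact_Suc)
    also have "eval_fps (fps_deriv (T_fps (Suc a))) t - 
            of_nat (Suc a) * Ln ((1 + t) / (1 - t)) ^ a * (2 / (1 - t\<^sup>2)) / fact (Suc a) = 0"
      using nz unfolding deriv by (simp add: field_simps del: of_nat_Suc)
    finally show ?thesis
      using has_field_derivative_at_within by blast
  qed
  hence "\<exists>c. \<forall>t\<in>ball 0 1. D t = c"
    by (intro has_field_derivative_zero_constant) auto
  hence "D t = D 0"
    using Suc.prems by auto
  also have "D 0 = 0"
    by (simp add: D_def eval_fps_at_0)
  finally show ?case
    by (simp add: D_def)
qed

section \<open>Multiple T-values as Dirichlet series\<close>

lemma T_indices_0: "T_indices 0 = {[]}"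
  by (auto simp: T_indices_def)

text \<open>Prepending 0 gives the empty tuple the last entry 0. One inequality then expresses both
  monotonicity and positivity of the new entry, and the empty tuple matches
  \<open>T_coeff 0\<close>.\<close>

lemma T_indices_Suc:
  "T_indices (Suc a) = {ms @ [n] | ms n. ms \<in> T_indices a \<and> last (0 # ms) < n \<and> [n = a + 1] (mod 2)}"
proof (intro equalityI subsetI)
  fix xs assume xs: "xs \<in> T_indices (Suc a)"
  then obtain ms n where xs_eq: "xs = ms @ [n]"
    by (cases xs rule: rev_cases) (auto simp: T_indices_def)
  have len: "length ms = a"
    using xs by (simp add: T_indices_def xs_eq)
  have nth: "0 < xs ! j \<and> [xs ! j = j + 1] (mod 2)" if "j < Suc a" for j
    using xs that by (simp add: T_indices_def)
  have "0 < n \<and> [n = a + 1] (mod 2)"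
    using nth[of a] len by (simp add: xs_eq nth_append)
  moreover have "0 < ms ! j \<and> [ms ! j = j + 1] (mod 2)" if "j < a" for j
    using nth[of j] that len by (simp add: xs_eq nth_append)
  hence "ms \<in> T_indices a"
    using xs len by (simp add: T_indices_def xs_eq sorted_wrt_append)
  moreover have "\<forall>x\<in>set ms. x < n"
    using xs by (auto simp: T_indices_def xs_eq sorted_wrt_append)
  ultimately show "xs \<in> {ms @ [n] | ms n. ms \<in> T_indices a \<and> last (0 # ms) < n \<and> [n = a + 1] (mod 2)}"
    using xs_eq by auto
next
  fix xs assume "xs \<in> {ms @ [n] | ms n. ms \<in> T_indices a \<and> last (0 # ms) < n \<and> [n = a + 1] (mod 2)}"
  then obtain ms n where *: "xs = ms @ [n]" "ms \<in> T_indices a" "last (0 # ms) < n" "[n = a + 1] (mod 2)"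
    by auto
  have "x \<le> last (0 # ms)" if "x \<in> set ms" for x
  proof -
    have "ms \<noteq> []"
      using that by auto
    hence "ms = butlast ms @ [last ms]" "sorted_wrt (<) ms"
      using *(2) by (simp_all add: T_indices_def)
    hence "sorted_wrt (<) (butlast ms @ [last ms])" "x \<in> set (butlast ms @ [last ms])"
      using that by simp_all
    thus ?thesis
      using that by (auto simp: sorted_wrt_append)
  qed
  with * show "xs \<in> T_indices (Suc a)"
    by (force simp: T_indices_def sorted_wrt_append nth_append less_Suc_eq)
qed

lemma T_indices_last_Suc:
  "{ms \<in> T_indices (Suc a). last (0 # ms) = n} =
     (if [n = a + 1] (mod 2) then \<Union>m<n. (\<lambda>ms. ms @ [n]) ` {ms \<in> T_indices a. last (0 # ms) = m} else {})"
proof -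
  have "last (0 # ms @ [n]) = n" for ms and n :: nat
    by simp
  thus ?thesis
    by (auto simp: T_indices_Suc simp del: last.simps split: if_splits)
qed

lemma finite_T_indices_last: "finite {ms \<in> T_indices a. last (0 # ms) = n}"
proof (induction a arbitrary: n)
  case (Suc a)
  show ?case
    unfolding T_indices_last_Suc by (simp add: Suc del: last.simps)
qed (simp add: T_indices_0)

text \<open>Removing the last entry \<open>n\<close> splits off a factor \<open>2 / n\<close> and
  leaves tuples ending at some \<open>m < n\<close>, which is the recurrence of
  \<open>T_coeff\<close>. The absolute parity condition on tuples and the relative one in the
  recurrence agree by \<open>T_coeff_parity\<close>.\<close>

lemma sum_T_indices_last:
  "2 ^ a * (\<Sum>ms | ms \<in> T_indices a \<and> last (0 # ms) = n. \<Prod>j<a. 1 / real (ms ! j)) = T_coeff a n"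
proof (induction a arbitrary: n)
  case 0
  have "{ms. ms \<in> T_indices 0 \<and> last (0 # ms) = n} = (if n = 0 then {[]} else {})"
    by (auto simp: T_indices_0)
  thus ?case by simp
next
  case (Suc a)
  show ?case
  proof (cases "[n = a + 1] (mod 2)")
    case False
    have "odd (Suc a + n)"
      using False unfolding cong_def by presburger
    hence "T_coeff (Suc a) n = 0"
      using T_coeff_parity by blast
    thus ?thesis
      using False by (simp add: T_indices_last_Suc del: T_coeff.simps last.simps)
  next
    case True
    let ?A = "\<lambda>m. {ms \<in> T_indices a. last (0 # ms) = m}"
    have "(\<Sum>ms | ms \<in> T_indices (Suc a) \<and> last (0 # ms) = n. \<Prod>j<Suc a. 1 / real (ms ! j)) =
          (\<Sum>m<n. \<Sum>ms\<in>(\<lambda>ms. ms @ [n]) ` ?A m. \<Prod>j<Suc a. 1 / real (ms ! j))"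
      unfolding T_indices_last_Suc using True finite_T_indices_last
      by (simp del: last.simps, subst sum.UNION_disjoint) (auto simp del: last.simps)
    also have "\<dots> = (\<Sum>m<n. \<Sum>ms\<in>?A m. (\<Prod>j<a. 1 / real (ms ! j)) * (1 / real n))"
    proof (rule sum.cong [OF refl])
      fix m
      have "(\<Sum>ms\<in>(\<lambda>ms. ms @ [n]) ` ?A m. \<Prod>j<Suc a. 1 / real (ms ! j)) =
            (\<Sum>ms\<in>?A m. \<Prod>j<Suc a. 1 / real ((ms @ [n]) ! j))"
        by (subst sum.reindex) (auto simp: inj_on_def)
      also have "\<dots> = (\<Sum>ms\<in>?A m. (\<Prod>j<a. 1 / real (ms ! j)) * (1 / real n))"
        by (intro sum.cong refl) (auto simp: T_indices_def nth_append simp del: last.simps)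
      finally show "(\<Sum>ms\<in>(\<lambda>ms. ms @ [n]) ` ?A m. \<Prod>j<Suc a. 1 / real (ms ! j)) = \<dots>" .
    qed
    also have "\<dots> = (\<Sum>m<n. T_coeff a m / 2 ^ a * (1 / real n))"
      unfolding sum_distrib_right [symmetric] Suc [symmetric] by simp
    also have "\<dots> = (\<Sum>m<n. T_coeff a m) / (2 ^ a * real n)"
      by (simp add: sum_divide_distrib)
    \<comment> \<open>The added terms have an \<open>m\<close> of the wrong parity and
      vanish.\<close>
    also have "(\<Sum>m<n. T_coeff a m) = (\<Sum>m | m < n \<and> odd (n - m). T_coeff a m)"
    proof (intro sum.mono_neutral_right ballI)
      fix m assume "m \<in> {..<n} - {m. m < n \<and> odd (n - m)}"
      hence "m < n" "even (n - m)"
        by auto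
      hence "odd (a + m)"
        using True unfolding cong_def by presburger
      thus "T_coeff a m = 0"
        using T_coeff_parity by blast
    qed auto
    finally show ?thesis
      by simp
  qed
qed

text \<open>All terms are nonnegative, so the tuples may be grouped by their last entry
  \<open>n\<close>. Of its exponent \<open>k + 1\<close>, one factor \<open>1 / n\<close> belongs to
  the coefficient and \<open>n ^ k\<close> remains.\<close>

lemma T_value_has_sum:
  assumes "a > 0" "k > 0"
  shows "((\<lambda>n. T_coeff a n / real n ^ k) has_sum T_value (replicate (a - 1) 1 @ [k + 1])) UNIV"
proof -
  obtain d where a: "a = Suc d"
    using assms by (cases a) auto
  let ?ks = "replicate (a - 1) 1 @ [k + 1]"
  define f where "f = (\<lambda>ms. 2 ^ a * (\<Prod>j<length ?ks. 1 / real (ms ! j) ^ (?ks ! j)))"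
  define A where "A = (\<lambda>n. {ms \<in> T_indices a. last (0 # ms) = n})"
  have f_eq: "f ms = 2 ^ a * (\<Prod>j<a. 1 / real (ms ! j)) / real n ^ k" if "ms \<in> A n" for ms n
  proof -
    have "ms ! d = n"
      using that by (auto simp: A_def T_indices_def a last_conv_nth split: if_splits)
    moreover have "(\<Prod>j<d. 1 / real (ms ! j) ^ (?ks ! j)) = (\<Prod>j<d. 1 / real (ms ! j))"
      by (intro prod.cong refl) (simp add: a nth_append)
    ultimately show ?thesis
      by (simp add: f_def a nth_append)
  qed
  have 1: "(f has_sum (T_coeff a n / real n ^ k)) (A n)" for n
  proof -
    have "sum f (A n) = T_coeff a n / real n ^ k"
      by (simp add: f_eq A_def flip: sum_T_indices_last sum_distrib_left sum_divide_distrib)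
    thus ?thesis
      using finite_T_indices_last unfolding A_def by (metis has_sum_finite)
  qed
  have "summable (\<lambda>n. T_coeff a n / real n ^ k)"
  proof (rule summable_comparison_test'[OF summable_T_coeff_div[OF assms(1)]])
    fix n :: nat
    show "norm (T_coeff a n / real n ^ k) \<le> T_coeff a n / real n"
      using assms self_le_power[of "real n" k]
      by (cases "n = 0") (auto simp: T_coeff_nonneg intro!: divide_left_mono)
  qed
  hence 2: "(\<lambda>n. T_coeff a n / real n ^ k) summable_on UNIV"
    by (intro summable_nonneg_imp_summable_on) (auto simp: T_coeff_nonneg)
  have disj: "disjoint_family_on A UNIV"
    by (auto simp: disjoint_family_on_def A_def)
  have Un: "(\<Union>n. A n) = T_indices a"
    by (auto simp: A_def)
  have "f summable_on (\<Union>n. A n)"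
    by (rule summable_on_UnionI[OF 1 2 _ disj]) (simp add: f_def prod_nonneg)
  hence "(f has_sum infsum f (T_indices a)) (\<Union>n. A n)"
    unfolding Un by simp
  \<comment> \<open>Disjointness turns the sum over the union into a double sum over the last entry
    and the tuples ending with it.\<close>
  also have "(\<Union>n. A n) = snd ` Sigma UNIV A"
    by force
  finally have "(f \<circ> snd has_sum infsum f (T_indices a)) (Sigma UNIV A)"
    by (subst has_sum_reindex [symmetric])
      (auto simp: inj_on_def A_def)
  hence "((\<lambda>n. T_coeff a n / real n ^ k) has_sum infsum f (T_indices a)) UNIV"
    by (rule has_sum_SigmaD) (use 1 in auto)
  also have "infsum f (T_indices a) = T_value ?ks"
    unfolding T_value_def f_def infsum_cmult_right' using a by simp
  finally show ?thesis .
qed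

section \<open>The Bernoulli series\<close>

definition bernoulli_diff_fps :: "complex fps" where
  "bernoulli_diff_fps = Abs_fps (\<lambda>k. (1 - 2 ^ k) * of_real (bernoulli k) / fact k)"

text \<open>With \<open>A\<close> the series of \<open>x / (exp x - 1)\<close>, the coefficients are
  those of \<open>A(x) - A(2 * x)\<close>, and \<open>x / (exp x - 1) - 2 * x / (exp (2 * x) - 1) =
  x / (exp x + 1)\<close>.\<close>

lemma bernoulli_diff_fps_eq: "bernoulli_diff_fps * (fps_exp 1 + 1) = fps_X"
proof -
  define A :: "complex fps" where "A = Abs_fps (\<lambda>k. of_real (bernoulli k / fact k))"
  define E :: "complex fps" where "E = fps_exp 1"
  let ?A2 = "fps_compose A (fps_const 2 * fps_X)"
  have A: "A * (E - 1) = fps_X"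
  proof (rule fps_ext)
    fix n
    have E: "fps_nth (E - 1) j = of_real (fps_nth (fps_exp 1 - 1) j)" for j
      by (simp add: E_def)
    have "fps_nth (A * (E - 1)) n =
          of_real (fps_nth (Abs_fps (\<lambda>k. bernoulli k / fact k) * (fps_exp 1 - 1)) n)"
      unfolding fps_mult_nth E of_real_sum of_real_mult A_def by simp
    thus "fps_nth (A * (E - 1)) n = fps_nth fps_X n"
      by (simp add: bernoulli_generating_function)
  qed
  have "fps_compose (A * (E - 1)) (fps_const 2 * fps_X) = fps_compose fps_X (fps_const 2 * fps_X)"
    by (simp only: A)
  hence A2: "?A2 * (E ^ 2 - 1) = 2 * fps_X"
    by (simp add: fps_compose_mult_distrib fps_compose_sub_distrib E_def fps_exp_power_mult numeral_fps_const)
  have "bernoulli_diff_fps = A - ?A2"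
    by (rule fps_ext) (simp only: fps_sub_nth fps_nth_compose_linear,
      simp add: bernoulli_diff_fps_def A_def field_simps)
  \<comment> \<open>The series \<open>E - 1\<close> has constant term 0 and no inverse, so both
    sides are multiplied by it and it is cancelled as a nonzero factor.\<close>
  hence "(bernoulli_diff_fps * (E + 1)) * (E - 1) = ((A - ?A2) * (E + 1)) * (E - 1)"
    by (simp only:)
  also have "\<dots> = (A * (E - 1)) * (E + 1) - ?A2 * (E ^ 2 - 1)"
    by (simp add: algebra_simps power2_eq_square)
  also have "\<dots> = fps_X * (E - 1)"
    unfolding A A2 by (simp add: algebra_simps)
  finally have "(bernoulli_diff_fps * (E + 1)) * (E - 1) = fps_X * (E - 1)" .
  moreover have "fps_nth (E - 1) 1 \<noteq> 0"
    by (simp add: E_def)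
  hence "E - 1 \<noteq> 0"
    by (metis fps_zero_nth)
  ultimately have "bernoulli_diff_fps * (E + 1) = fps_X"
    by (rule mult_right_cancel [THEN iffD1, rotated])
  thus ?thesis
    by (simp add: E_def)
qed

text \<open>The zeros of \<open>exp w + 1\<close> are the odd multiples of \<open>pi * \<i>\<close>;
  an odd integer has absolute value at least 1.\<close>

lemma exp_plus_1_nonzero:
  assumes "norm (w :: complex) < pi"
  shows "exp w + 1 \<noteq> 0"
proof
  assume "exp w + 1 = 0"
  hence "exp w = -1"
    unfolding eq_neg_iff_add_eq_0 .
  hence "exp w = exp (\<i> * pi)"
    by simp
  then obtain n :: int where n: "w = \<i> * pi + (of_int (2 * n) * pi) * \<i>"
    unfolding exp_eq by blast
  hence "w = of_real ((1 + 2 * of_int n) * pi) * \<i>"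
    by (simp add: algebra_simps)
  hence "norm w = \<bar>(1 + 2 * real_of_int n) * pi\<bar>"
    by (simp only: norm_mult norm_of_real norm_ii mult_1_right)
  hence "norm w = \<bar>1 + 2 * real_of_int n\<bar> * pi"
    by (simp add: abs_mult)
  moreover have "1 \<le> \<bar>1 + 2 * n\<bar>"
    by presburger
  hence "real_of_int 1 \<le> real_of_int \<bar>1 + 2 * n\<bar>"
    by (simp only: of_int_le_iff)
  ultimately have "norm w \<ge> pi"
    by (simp add: mult_le_cancel_right1)
  thus False
    using assms by simp
qed

text \<open>The function is holomorphic on the disc of radius \<open>pi\<close>, so its expansion at
  0 converges absolutely there. The point \<open>- pi * \<i> * X\<close> lies in this disc when
  \<open>norm X < 1\<close>.\<close>

lemma
  assumes "norm w < pi"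
  shows summable_bernoulli_diff: "summable (\<lambda>k. norm (fps_nth bernoulli_diff_fps k * w ^ k))"
    and eval_bernoulli_diff: "(\<lambda>k. fps_nth bernoulli_diff_fps k * w ^ k) sums (w / (exp w + 1))"
proof -
  let ?f = "\<lambda>w :: complex. w / (exp w + 1)"
  have holo: "?f holomorphic_on ball 0 pi"
    by (intro holomorphic_intros) (auto dest: exp_plus_1_nonzero)
  have "(\<lambda>w :: complex. exp w + 1) has_fps_expansion (fps_exp 1 + 1)"
    by (intro fps_expansion_intros)
  hence "?f has_fps_expansion (fps_X / (fps_exp 1 + 1))"
    by (intro fps_expansion_intros) auto
  also have "fps_X / (fps_exp 1 + 1) = bernoulli_diff_fps"
  proof -
    have "fps_nth (fps_exp 1 + 1 :: complex fps) 0 \<noteq> 0" by simp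
    hence "fps_exp 1 + 1 \<noteq> (0 :: complex fps)" by force
    thus ?thesis
      by (metis bernoulli_diff_fps_eq nonzero_mult_div_cancel_right)
  qed
  finally have exp: "?f has_fps_expansion bernoulli_diff_fps" .
  have "norm w < fps_conv_radius bernoulli_diff_fps"
    by (rule less_le_trans[OF _ holomorphic_on_imp_fps_conv_radius_ge[OF exp, of pi]])
       (use assms holo in auto)
  thus "summable (\<lambda>k. norm (fps_nth bernoulli_diff_fps k * w ^ k))"
    unfolding fps_conv_radius_def by (rule abs_summable_in_conv_radius)
  show "(\<lambda>k. fps_nth bernoulli_diff_fps k * w ^ k) sums ?f w"
    by (rule has_fps_expansion_imp_sums_complex[OF exp, of pi]) (use assms holo in auto)
qed

section \<open>Integration along the arc and the segment\<close>

text \<open>A bound linear in \<open>n\<close> lets the denominators \<open>n - X\<close> be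
  compared with \<open>n\<close> at the cost of a constant factor.\<close>

lemma norm_of_nat_minus_ge:
  fixes X :: "'a :: real_normed_field"
  assumes "norm X < 1" "n > 0"
  shows "norm (of_nat n - X) \<ge> (1 - norm X) * real n"
proof -
  have "(1 - norm X) * real n = real n - norm X * real n"
    by (simp add: algebra_simps)
  also have "\<dots> \<le> real n - norm X * 1"
    using assms by (intro diff_left_mono mult_left_mono) auto
  also have "\<dots> \<le> norm (of_nat n - X)"
    using norm_triangle_ineq2[of "of_nat n" X] by simp
  finally show ?thesis .
qed

lemma norm_less_1_neq_of_nat:
  fixes X :: "'a :: real_normed_field"
  assumes "norm X < 1" "n > 0"
  shows "of_nat n - X \<noteq> 0"
proof
  assume "of_nat n - X = 0"
  with norm_of_nat_minus_ge[OF assms] have "(1 - norm X) * real n \<le> 0"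
    by simp
  with assms show False
    by (auto simp: mult_le_0_iff)
qed

lemma summable_T_coeff_div_minus:
  fixes X :: "'a :: real_normed_field"
  assumes "a > 0" "norm X < 1"
  shows "summable (\<lambda>n. T_coeff a n / norm (of_nat n - X))"
proof -
  have "summable (\<lambda>n. T_coeff a n / real n / (1 - norm X))"
    by (intro summable_divide summable_T_coeff_div assms)
  thus ?thesis
  proof (rule summable_comparison_test')
    fix n :: nat
    show "norm (T_coeff a n / norm (of_nat n - X)) \<le> T_coeff a n / real n / (1 - norm X)"
    proof (cases "n = 0")
      case False
      hence "T_coeff a n / norm (of_nat n - X) \<le> T_coeff a n / ((1 - norm X) * real n)"
        using assms by (intro divide_left_mono norm_of_nat_minus_ge T_coeff_nonneg)
          (auto intro!: mult_pos_pos simp: norm_less_1_neq_of_nat)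
      thus ?thesis
        by (simp add: T_coeff_nonneg mult.commute)
    qed (use assms in auto)
  qed
qed

text \<open>
  Multiplied by \<open>t powr (- X)\<close>, the sum of this series is a primitive of
  \<open>t powr (- X - 1) * Ln ((1 + t) / (1 - t)) ^ a / fact a\<close>.
\<close>

definition T_primitive_fps :: "nat \<Rightarrow> complex \<Rightarrow> complex fps" where
  "T_primitive_fps a X = Abs_fps (\<lambda>n. of_real (T_coeff a n) / (of_nat n - X))"

lemma T_primitive_fps_nth [simp]: "fps_nth (T_primitive_fps a X) n = of_real (T_coeff a n) / (of_nat n - X)"
  by (simp add: T_primitive_fps_def)

abbreviation T_primitive :: "nat \<Rightarrow> complex \<Rightarrow> complex \<Rightarrow> complex" where
  "T_primitive a X \<equiv> eval_fps (T_primitive_fps a X)"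

lemma T_primitive_0: "a > 0 \<Longrightarrow> T_primitive a X 0 = 0"
  by (simp add: eval_fps_at_0)

section \<open>The shifted series on the closed unit disc\<close>

context
  fixes a :: nat and X :: complex
  assumes a: "a > 0" and X: "norm X < 1"
begin

text \<open>The constant coefficient vanishes, so one factor \<open>norm t\<close> can be kept. It
  yields uniform convergence on the closed disc as well as linear decay at 0.\<close>

lemma norm_T_primitive_term_le:
  assumes "norm t \<le> 1"
  shows "norm (fps_nth (T_primitive_fps a X) n * t ^ n) \<le> T_coeff a n / norm (of_nat n - X) * norm t"
proof (cases "n = 0")
  case False
  have "norm t ^ n \<le> norm t"
    using power_decreasing[of 1 n "norm t"] assms False by simp
  hence "T_coeff a n / norm (of_nat n - X) * norm t ^ n \<le> T_coeff a n / norm (of_nat n - X) * norm t"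
    by (intro mult_left_mono) (auto simp: T_coeff_nonneg)
  thus ?thesis
    by (simp add: norm_mult norm_power norm_divide T_coeff_nonneg)
qed (use a in auto)

lemma summable_norm_T_primitive:
  assumes "norm t \<le> 1"
  shows "summable (\<lambda>n. norm (fps_nth (T_primitive_fps a X) n * t ^ n))"
proof (rule summable_comparison_test')
  show "summable (\<lambda>n. T_coeff a n / norm (of_nat n - X) * norm t)"
    by (intro summable_mult2 summable_T_coeff_div_minus a X)
  show "norm (norm (fps_nth (T_primitive_fps a X) n * t ^ n)) \<le> T_coeff a n / norm (of_nat n - X) * norm t" for n
    using norm_T_primitive_term_le[OF assms] by (simp del: T_primitive_fps_nth)
qed

lemma norm_T_primitive_le:
  assumes "norm t \<le> 1"
  shows "norm (T_primitive a X t) \<le> (\<Sum>n. T_coeff a n / norm (of_nat n - X)) * norm t"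
proof -
  note s = summable_T_coeff_div_minus[OF a X]
  have "norm (T_primitive a X t) \<le> (\<Sum>n. norm (fps_nth (T_primitive_fps a X) n * t ^ n))"
    unfolding eval_fps_def by (intro summable_norm summable_norm_T_primitive assms)
  also have "\<dots> \<le> (\<Sum>n. T_coeff a n / norm (of_nat n - X) * norm t)"
    by (intro suminf_le norm_T_primitive_term_le summable_norm_T_primitive assms summable_mult2 s)
  also have "\<dots> = (\<Sum>n. T_coeff a n / norm (of_nat n - X)) * norm t"
    by (rule suminf_mult2 [OF s, symmetric])
  finally show ?thesis .
qed

text \<open>The Weierstrass test reaches the whole boundary, including \<open>t = 1\<close>, where
  the logarithm itself is singular.\<close>

lemma continuous_on_T_primitive: "continuous_on (cball 0 1) (T_primitive a X)"
proof (rule uniform_limit_theorem)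
  show "uniform_limit (cball 0 1) (\<lambda>N t. \<Sum>n<N. fps_nth (T_primitive_fps a X) n * t ^ n) (T_primitive a X) sequentially"
    unfolding eval_fps_def
  proof (rule Weierstrass_m_test)
    fix n :: nat and t :: complex assume t: "t \<in> cball 0 1"
    hence "norm (fps_nth (T_primitive_fps a X) n * t ^ n) \<le> T_coeff a n / norm (of_nat n - X) * norm t"
      by (intro norm_T_primitive_term_le) auto
    also have "\<dots> \<le> T_coeff a n / norm (of_nat n - X) * 1"
      using t by (intro mult_left_mono) (auto simp: T_coeff_nonneg)
    finally show "norm (fps_nth (T_primitive_fps a X) n * t ^ n) \<le> T_coeff a n / norm (of_nat n - X)"
      by simp
  qed (rule summable_T_coeff_div_minus[OF a X])
qed (auto intro!: always_eventually continuous_on_sum continuous_on_mult continuous_on_power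
    continuous_on_const continuous_on_id simp del: T_primitive_fps_nth)

lemma conv_radius_T_primitive_fps: "fps_conv_radius (T_primitive_fps a X) \<ge> 1"
proof -
  have "summable (\<lambda>n. fps_nth (T_primitive_fps a X) n * 1 ^ n)"
    by (rule summable_norm_cancel [OF summable_norm_T_primitive]) simp
  hence "fps_conv_radius (T_primitive_fps a X) \<ge> norm (1 :: complex)"
    unfolding fps_conv_radius_def by (rule conv_radius_geI)
  thus ?thesis
    by (simp add: one_ereal_def)
qed

lemma has_field_derivative_T_primitive:
  assumes "norm t < 1"
  obtains H' where "(T_primitive a X has_field_derivative H') (at t)"
    "t * H' = X * T_primitive a X t + Ln ((1 + t) / (1 - t)) ^ a / fact a"
proof
  have t: "ereal (norm t) < fps_conv_radius (T_primitive_fps a X)"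
    by (rule less_le_trans[OF _ conv_radius_T_primitive_fps]) (use assms in auto)
  hence t': "ereal (norm t) < fps_conv_radius (fps_deriv (T_primitive_fps a X))"
    by (rule less_le_trans[OF _ fps_conv_radius_deriv])
  show "(T_primitive a X has_field_derivative eval_fps (fps_deriv (T_primitive_fps a X)) t) (at t)"
    by (rule has_field_derivative_eval_fps) fact
  \<comment> \<open>The operator \<open>t * d/dt\<close> multiplies the coefficient by
    \<open>n = X + (n - X)\<close>, and the second part cancels the denominator.\<close>
  have "fps_X * fps_deriv (T_primitive_fps a X) = fps_const X * T_primitive_fps a X + T_fps a"
  proof (rule fps_ext)
    fix n :: nat
    show "fps_nth (fps_X * fps_deriv (T_primitive_fps a X)) n = fps_nth (fps_const X * T_primitive_fps a X + T_fps a) n"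
    proof (cases n)
      case (Suc m)
      have "of_nat n - X \<noteq> 0"
        by (rule norm_less_1_neq_of_nat) (use X Suc in auto)
      thus ?thesis
        by (simp add: Suc field_simps)
    qed (use a in simp)
  qed
  hence "eval_fps (fps_X * fps_deriv (T_primitive_fps a X)) t = eval_fps (fps_const X * T_primitive_fps a X + T_fps a) t"
    by simp
  also have "eval_fps (fps_X * fps_deriv (T_primitive_fps a X)) t = t * eval_fps (fps_deriv (T_primitive_fps a X)) t"
    by (subst eval_fps_mult) (use t' in auto)
  also have "eval_fps (fps_const X * T_primitive_fps a X + T_fps a) t = X * T_primitive a X t + eval_fps (T_fps a) t"
  proof -
    have "ereal (norm t) < fps_conv_radius (fps_const X * T_primitive_fps a X)"
      by (rule less_le_trans[OF _ fps_conv_radius_mult]) (use t in auto)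
    moreover have "ereal (norm t) < fps_conv_radius (T_fps a)"
      by (rule less_le_trans[OF _ conv_radius_T_fps]) (use assms in auto)
    ultimately show ?thesis
      using t by (simp add: eval_fps_add eval_fps_mult)
  qed
  finally show "t * eval_fps (fps_deriv (T_primitive_fps a X)) t = X * T_primitive a X t + Ln ((1 + t) / (1 - t)) ^ a / fact a"
    using assms by (simp add: eval_T_fps)
qed

end

text \<open>Half-angle formulas turn the quotient into \<open>\<i>\<close> times the cotangent of
  \<open>\<phi> / 2\<close>, which is positive in this range.\<close>

lemma Ln_cayley_cis:
  assumes "0 < \<phi>" "\<phi> < pi"
  shows "Ln ((1 + cis \<phi>) / (1 - cis \<phi>)) = of_real pi / 2 * \<i> - of_real (ln (tan (\<phi> / 2)))"
proof -
  define c s where "c = cos (\<phi> / 2)" and "s = sin (\<phi> / 2)"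
  have pos: "c > 0" "s > 0"
    using assms by (auto simp: c_def s_def intro: cos_gt_zero_pi sin_gt_zero)
  have [simp]: "tan (\<phi> / 2) = s / c"
    by (simp add: tan_def s_def c_def)
  have half: "cis \<phi> = Complex c s * Complex c s"
    by (simp add: c_def s_def cis_mult flip: cis.code)
  have cs: "c * c + s * s = 1"
    using sin_cos_squared_add2[of "\<phi> / 2"] by (simp add: c_def s_def)
  have plus: "1 + cis \<phi> = 2 * of_real c * Complex c s"
    unfolding half using cs by (auto simp: complex_eq_iff algebra_simps)
  have minus: "1 - cis \<phi> = - 2 * \<i> * of_real s * Complex c s"
    unfolding half using cs by (auto simp: complex_eq_iff algebra_simps)
  have "Complex c s \<noteq> 0"
    using pos by (auto simp: complex_eq_iff)
  hence "(1 + cis \<phi>) / (1 - cis \<phi>) = of_real (c / s) * \<i>"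
    unfolding plus minus using pos by (simp add: field_simps)
  also have "Ln \<dots> = of_real (ln (c / s)) + \<i> * of_real pi / 2"
    using pos by (subst Ln_times_of_real) (auto simp: Ln_of_real simp del: of_real_divide)
  also have "ln (c / s) = - ln (s / c)"
    using pos by (simp add: ln_div)
  finally show ?thesis
    by simp
qed

text \<open>The quotient is \<open>cis (\<theta> / 2)\<close> over its conjugate, that is
  \<open>cis \<theta>\<close>, and \<theta> lies in the principal range.\<close>

lemma Ln_cayley_tan:
  assumes "0 < \<theta>" "\<theta> < pi"
  shows "Ln ((1 + \<i> * of_real (tan (\<theta> / 2))) / (1 - \<i> * of_real (tan (\<theta> / 2)))) = \<i> * of_real \<theta>"
proof -
  define c s where "c = cos (\<theta> / 2)" and "s = sin (\<theta> / 2)"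
  have pos: "c > 0"
    using assms by (auto simp: c_def intro: cos_gt_zero_pi)
  have [simp]: "tan (\<theta> / 2) = s / c"
    by (simp add: tan_def s_def c_def)
  have "(1 + \<i> * of_real (s / c)) / (1 - \<i> * of_real (s / c)) = (of_real c + \<i> * of_real s) / (of_real c - \<i> * of_real s)"
    using pos by (simp add: divide_simps)
  also have "of_real c + \<i> * of_real s = cis (\<theta> / 2)"
    by (simp add: complex_eq_iff c_def s_def)
  also have "of_real c - \<i> * of_real s = cis (- \<theta> / 2)"
    by (simp add: complex_eq_iff c_def s_def)
  also have "cis (\<theta> / 2) / cis (- \<theta> / 2) = cis \<theta>"
    by (simp add: cis_divide)
  finally show ?thesis
    using assms by (simp add: Ln_cis mult.commute)
qed

context
  fixes a :: nat and X :: complex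
  assumes a: "a > 0" and X: "norm X < 1"
begin

text \<open>
  On the unit circle the differentiated series no longer converges absolutely. Instead, a primitive
  on the upper half plane is compared with the series inside the disc, up to the boundary.
\<close>

lemma has_vector_derivative_arc:
  assumes \<phi>: "0 < \<phi>" "\<phi> < pi"
  shows "((\<lambda>\<phi>. exp (- \<i> * of_real \<phi> * X) * T_primitive a X (cis \<phi>)) has_vector_derivative
            \<i> * exp (- \<i> * of_real \<phi> * X) * (of_real pi / 2 * \<i> - of_real (ln (tan (\<phi> / 2)))) ^ a / fact a)
         (at \<phi>)"
proof -
  define U where "U = {t. Im t > 0}"
  define g where "g = (\<lambda>t. t powr (- X - 1) * (Ln ((1 + t) / (1 - t)) ^ a / fact a))"
  define W where "W = (\<lambda>t. t powr (- X) * T_primitive a X t)"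
  have U: "open U" "convex U"
    unfolding U_def by (simp_all add: open_halfspace_Im_gt convex_halfspace_Im_gt)
  have U': "t \<notin> \<real>\<^sub>\<le>\<^sub>0" "t \<noteq> 0" "t \<noteq> 1" "(1 + t) / (1 - t) \<notin> \<real>\<^sub>\<le>\<^sub>0" if "t \<in> U" for t
    using that Im_cayley_pos[of t] by (auto simp: U_def complex_nonpos_Reals_iff)
  \<comment> \<open>The convex half plane contains the open arc in its interior, so a holomorphic
    primitive of \<open>g\<close> exists on both sides of the arc.\<close>
  have "g holomorphic_on U"
    unfolding g_def by (intro holomorphic_intros) (use U' in auto)
  then obtain \<Phi> where \<Phi>: "(\<Phi> has_field_derivative g t) (at t within U)" if "t \<in> U" for t
    using holomorphic_convex_primitive' U by metis
  hence \<Phi>': "(\<Phi> has_field_derivative g t) (at t)" if "t \<in> U" for t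
    using that at_within_open[OF _ U(1)] by metis
  have W: "(W has_field_derivative g t) (at t)" if t: "t \<in> U \<inter> ball 0 1" for t
  proof -
    from t have "norm t < 1" by simp
    then obtain H' where H': "(T_primitive a X has_field_derivative H') (at t)"
      "t * H' = X * T_primitive a X t + Ln ((1 + t) / (1 - t)) ^ a / fact a"
      using has_field_derivative_T_primitive[OF a X] by metis
    note nz = U'(1,2)[of t]
    have *: "t powr (- X) = t * t powr (- X - 1)"
      using nz t by (simp add: powr_diff)
    have "(W has_field_derivative (- X) * t powr (- X - 1) * T_primitive a X t + H' * t powr (- X)) (at t)"
      unfolding W_def using nz t
      by (intro DERIV_mult H'(1) has_field_derivative_powr) auto
    also have "(- X) * t powr (- X - 1) * T_primitive a X t + H' * t powr (- X) =
                 t powr (- X - 1) * (t * H' - X * T_primitive a X t)"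
      by (simp add: * algebra_simps)
    also have "\<dots> = g t"
      by (simp add: H'(2) g_def)
    finally show ?thesis .
  qed
  have "((\<lambda>t. \<Phi> t - W t) has_field_derivative 0) (at t within U \<inter> ball 0 1)" if "t \<in> U \<inter> ball 0 1" for t
    using DERIV_diff[OF \<Phi>'[of t] W[OF that]] that by (auto intro: has_field_derivative_at_within)
  then obtain c where c: "\<And>t. t \<in> U \<inter> ball 0 1 \<Longrightarrow> \<Phi> t - W t = c"
    using has_field_derivative_zero_constant[of "U \<inter> ball 0 1" "\<lambda>t. \<Phi> t - W t"] U
    by (metis convex_Int convex_ball)
  \<comment> \<open>The constant is carried to the circle along the radius. Starting at
    \<open>1 / 2\<close> stays away from 0, where the complex power is singular.\<close>
  have c': "\<Phi> t - W t = c" if t: "t \<in> U" "norm t = 1" for t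
  proof -
    let ?S = "{1 / 2..<1 :: real}"
    have in_U: "of_real r * t \<in> U" if "r \<in> {1/2..1}" for r
      using that t by (auto simp: U_def intro!: mult_pos_pos)
    have "continuous_on (closure ?S) (\<lambda>r. \<Phi> (of_real r * t) - W (of_real r * t))"
    proof -
      have "continuous_on U \<Phi>"
        using \<Phi>' by (meson DERIV_isCont continuous_at_imp_continuous_on)
      hence 1: "continuous_on {1/2..1} (\<lambda>r. \<Phi> (of_real r * t))"
        by (rule continuous_on_compose2) (use in_U in \<open>auto intro!: continuous_intros\<close>)
      have 2: "continuous_on {1/2..1} (\<lambda>r. T_primitive a X (of_real r * t))"
        by (rule continuous_on_compose2[OF continuous_on_T_primitive[OF a X]])
          (use t in \<open>auto intro!: continuous_intros simp: norm_mult\<close>)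
      have 3: "continuous_on {1/2..1} (\<lambda>r. (of_real r * t) powr (- X))"
        by (intro continuous_intros) (use t in \<open>auto simp: U_def\<close>)
      have "continuous_on {1/2..1} (\<lambda>r. \<Phi> (of_real r * t) - W (of_real r * t))"
        unfolding W_def by (intro continuous_on_diff continuous_on_mult 1 2 3)
      thus ?thesis
        by simp
    qed
    moreover have "\<Phi> (of_real r * t) - W (of_real r * t) = c" if "r \<in> ?S" for r
      using that t in_U[of r] by (intro c) (auto simp: norm_mult)
    ultimately have "\<Phi> (of_real 1 * t) - W (of_real 1 * t) = c"
      by (rule continuous_constant_on_closure) (assumption, subst closure_atLeastLessThan, auto)
    thus ?thesis
      by simp
  qed
  have cis_powr: "cis \<psi> powr z = exp (\<i> * of_real \<psi> * z)" if "\<psi> \<in> {0<..<pi}" for \<psi> z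
    using that by (simp add: powr_def Ln_cis mult_ac)
  have cis_U: "cis \<psi> \<in> U" if "\<psi> \<in> {0<..<pi}" for \<psi>
    using that by (auto simp: U_def intro: sin_gt_zero)
  have "(cis has_vector_derivative \<i> * cis \<phi>) (at \<phi>)"
    unfolding cis_conv_exp by (rule has_vector_derivative_real_field) (auto intro!: derivative_eq_intros)
  hence "((\<Phi> \<circ> cis) has_vector_derivative (\<i> * cis \<phi> * g (cis \<phi>))) (at \<phi>)"
    by (rule field_vector_diff_chain_at) (use \<phi> in \<open>auto intro!: \<Phi>' cis_U\<close>)
  hence deriv: "((\<lambda>\<psi>. (\<Phi> \<circ> cis) \<psi> - c) has_vector_derivative (\<i> * cis \<phi> * g (cis \<phi>))) (at \<phi>)"
    by (auto intro!: derivative_eq_intros simp: o_def)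
  have eq: "(\<Phi> \<circ> cis) \<psi> - c = exp (- \<i> * of_real \<psi> * X) * T_primitive a X (cis \<psi>)" if "\<psi> \<in> {0<..<pi}" for \<psi>
    using c'[OF cis_U[OF that]] cis_powr[OF that, of "- X"] by (auto simp: W_def algebra_simps)
  have "((\<lambda>\<phi>. exp (- \<i> * of_real \<phi> * X) * T_primitive a X (cis \<phi>)) has_vector_derivative
      (\<i> * cis \<phi> * g (cis \<phi>))) (at \<phi>)"
    by (rule has_vector_derivative_transform_within_open[OF deriv open_greaterThanLessThan _ eq]) (use \<phi> in auto)
  \<comment> \<open>The factor \<open>cis \<phi>\<close> from the chain rule raises the exponent
    \<open>- X - 1\<close> to \<open>- X\<close>.\<close>
  also have "\<i> * cis \<phi> * g (cis \<phi>) = \<i> * (cis \<phi> * cis \<phi> powr (- X - 1)) * (Ln ((1 + cis \<phi>) / (1 - cis \<phi>)) ^ a / fact a)"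
    by (simp add: g_def)
  also have "cis \<phi> * cis \<phi> powr (- X - 1) = exp (\<i> * of_real \<phi> + \<i> * of_real \<phi> * (- X - 1))"
    using \<phi> cis_powr[of \<phi> "- X - 1"] by (simp only: greaterThanLessThan_iff cis_conv_exp exp_add)
  also have "\<i> * of_real \<phi> + \<i> * of_real \<phi> * (- X - 1) = - \<i> * of_real \<phi> * X"
    by (simp add: algebra_simps)
  finally show ?thesis
    using \<phi> by (simp add: Ln_cayley_cis)
qed

text \<open>The integrand is unbounded at the left end. The fundamental theorem still applies
  because the primitive is continuous up to the end points, where \<open>cis\<close> takes the
  values \<open>1\<close> and \<open>\<i>\<close>.\<close>

lemma has_integral_arc:
  "((\<lambda>\<phi>. \<i> * exp (- \<i> * of_real \<phi> * X) * (of_real pi / 2 * \<i> - of_real (ln (tan (\<phi> / 2)))) ^ a / fact a)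
     has_integral (exp (- \<i> * of_real pi * X / 2) * T_primitive a X \<i> - T_primitive a X 1)) {0..pi / 2}"
proof -
  let ?J = "\<lambda>\<phi>. exp (- \<i> * of_real \<phi> * X) * T_primitive a X (cis \<phi>)"
  have "continuous_on {0..pi/2} (\<lambda>\<phi>. T_primitive a X (cis \<phi>))"
    by (rule continuous_on_compose2[OF continuous_on_T_primitive[OF a X]]) (auto intro!: continuous_intros)
  hence "continuous_on {0..pi/2} ?J"
    by (intro continuous_on_mult) (intro continuous_intros)
  hence "((\<lambda>\<phi>. \<i> * exp (- \<i> * of_real \<phi> * X) * (of_real pi / 2 * \<i> - of_real (ln (tan (\<phi> / 2)))) ^ a / fact a)
     has_integral (?J (pi / 2) - ?J 0)) {0..pi / 2}"
    by (intro fundamental_theorem_of_calculus_interior has_vector_derivative_arc) auto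
  thus ?thesis
    by (simp add: cis_pi_half)
qed

end

section \<open>The segment from 0 to \<open>\<i>\<close>\<close>

lemma tan_half_pos:
  assumes "0 < \<theta>" "\<theta> \<le> pi / 2"
  shows "tan (\<theta> / 2) > 0"
  using assms by (intro tan_gt_zero) auto

lemma tan_half_less_1:
  assumes "0 \<le> \<theta>" "\<theta> < pi / 2"
  shows "tan (\<theta> / 2) < 1"
  using tan_monotone[of "\<theta> / 2" "pi / 4"] assms by (simp add: tan_45)

lemma tan_half_le_1:
  assumes "0 \<le> \<theta>" "\<theta> \<le> pi / 2"
  shows "tan (\<theta> / 2) \<le> 1"
proof (cases "\<theta> = pi / 2")
  case True
  thus ?thesis
    unfolding True by (simp add: tan_45)
qed (use tan_half_less_1[of \<theta>] assms in auto)

lemma le_tan_half: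
  assumes "0 \<le> \<theta>" "\<theta> \<le> pi / 2"
  shows "\<theta> \<le> 2 * tan (\<theta> / 2)"
proof -
  have "tan (\<theta> / 2) \<ge> 0"
    using assms tan_half_pos[of \<theta>] by (cases "\<theta> = 0") auto
  hence "arctan (tan (\<theta> / 2)) \<le> tan (\<theta> / 2)"
    by (rule arctan_le_self)
  also have "arctan (tan (\<theta> / 2)) = \<theta> / 2"
    by (rule arctan_tan) (use assms pi_gt_zero in linarith)+
  finally show ?thesis
    by simp
qed

context
  fixes a :: nat and X :: complex
  assumes a: "a > 0" and X: "norm X < 1"
begin

text \<open>
  The second summand is the boundary term of the integration by parts that turns \<open>X\<close> times the
  integral over the segment from \<open>0\<close> to \<open>\<i>\<close> into the integral of
  \<open>\<theta> ^ (a - 1) * exp (- X * ln (tan (\<theta> / 2)))\<close>.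
\<close>

definition segment_primitive :: "real \<Rightarrow> complex" where
  "segment_primitive \<theta> = exp (- X * of_real (ln (tan (\<theta> / 2)))) *
           (X * T_primitive a X (\<i> * of_real (tan (\<theta> / 2))) + (\<i> * of_real \<theta>) ^ a / fact a)"

text \<open>The exponential has modulus \<open>tan (\<theta> / 2) powr (- Re X)\<close>, while the
  bracket is of order \<open>tan (\<theta> / 2)\<close>. The product tends to 0 because
  \<open>Re X < 1\<close>.\<close>

lemma continuous_at_0_segment_primitive: "continuous (at 0 within {0..pi / 2}) segment_primitive"
proof -
  define M where "M = norm X * (\<Sum>n. T_coeff a n / norm (of_nat n - X)) + 2 * 2 ^ a"
  have "norm (segment_primitive \<theta>) \<le> M * tan (\<theta> / 2) powr (1 - Re X)" if \<theta>: "\<theta> \<in> {0<..pi / 2}" for \<theta>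
  proof -
    define s where "s = tan (\<theta> / 2)"
    have s: "0 < s" "s \<le> 1" "\<theta> \<le> 2 * s"
      using tan_half_pos[of \<theta>] tan_half_le_1[of \<theta>] le_tan_half[of \<theta>] \<theta> by (auto simp: s_def)
    have "norm (T_primitive a X (\<i> * of_real s)) \<le> (\<Sum>n. T_coeff a n / norm (of_nat n - X)) * norm (\<i> * of_real s)"
      using s by (intro norm_T_primitive_le a X) (auto simp: norm_mult)
    hence 1: "norm (X * T_primitive a X (\<i> * of_real s)) \<le> norm X * (\<Sum>n. T_coeff a n / norm (of_nat n - X)) * s"
      using s by (simp add: norm_mult mult_left_mono mult.assoc)
    have "norm ((\<i> * of_real \<theta>) ^ a / fact a :: complex) \<le> \<theta> ^ a"
      using \<theta> by (simp add: norm_divide norm_power norm_mult fact_ge_1 divide_le_eq mult_le_cancel_left1)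
    also have "\<theta> ^ a \<le> (2 * s) ^ a"
      using \<theta> s by (intro power_mono) auto
    also have "\<dots> \<le> 2 ^ a * s"
      using s a power_decreasing[of 1 a s] by (simp add: power_mult_distrib)
    also have "\<dots> \<le> 2 * 2 ^ a * s"
      using s by simp
    finally have "norm (X * T_primitive a X (\<i> * of_real s) + (\<i> * of_real \<theta>) ^ a / fact a) \<le> M * s"
      unfolding M_def ring_distribs using 1 by (intro norm_triangle_mono)
    hence "norm (segment_primitive \<theta>) \<le> exp (- Re X * ln s) * (M * s)"
      unfolding segment_primitive_def s_def [symmetric] norm_mult norm_exp_eq_Re
      by (intro mult_mono) auto
    also have "exp (- Re X * ln s) = s powr (- Re X)"
      using s by (simp add: powr_def)
    also have "s powr (- Re X) * (M * s) = M * (s powr (- Re X) * s powr 1)"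
      using s by simp
    also have "s powr (- Re X) * s powr 1 = s powr (1 - Re X)"
      by (subst powr_add [symmetric]) simp
    finally show ?thesis
      by (simp add: s_def)
  qed
  hence "eventually (\<lambda>\<theta>. norm (segment_primitive \<theta>) \<le> M * tan (\<theta> / 2) powr (1 - Re X)) (at 0 within {0..pi/2})"
    by (auto simp: eventually_at_filter)
  moreover have "((\<lambda>\<theta>. M * tan (\<theta> / 2) powr (1 - Re X)) \<longlongrightarrow> 0) (at 0 within {0..pi / 2})"
  proof -
    have "Re X < 1"
      using X complex_Re_le_cmod[of X] by linarith
    have "((\<lambda>\<theta>. tan (\<theta> / 2)) \<longlongrightarrow> tan (0 / 2 :: real)) (at 0 within {0..pi / 2})"
      by (intro tendsto_intros) auto
    hence "((\<lambda>\<theta>. tan (\<theta> / 2) powr (1 - Re X)) \<longlongrightarrow> 0 powr (1 - Re X)) (at 0 within {0..pi / 2})"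
      using \<open>Re X < 1\<close> tan_half_pos
      by (intro tendsto_powr2) (auto simp: eventually_at_filter le_less)
    from tendsto_mult_left[OF this, of M] show ?thesis
      by simp
  qed
  ultimately have "(segment_primitive \<longlongrightarrow> 0) (at 0 within {0..pi / 2})"
    by (rule Lim_null_comparison)
  \<comment> \<open>At 0 the bracket vanishes since \<open>a > 0\<close>, whatever default value the
    logarithm of 0 has.\<close>
  moreover have "segment_primitive 0 = 0"
    using a by (simp add: segment_primitive_def T_primitive_0)
  ultimately show ?thesis
    by (simp add: continuous_within)
qed

lemma continuous_on_segment_primitive: "continuous_on {0..pi / 2} segment_primitive"
proof -
  have cont: "continuous_on {0<..pi / 2} segment_primitive"
  proof -
    have tan: "continuous_on {0<..pi / 2} (\<lambda>\<theta>. tan (\<theta> / 2))"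
      by (intro continuous_intros) (auto simp: cos_gt_zero_pi less_imp_neq[symmetric])
    have le_1: "norm (\<i> * of_real (tan (\<theta> / 2))) \<le> 1" if "\<theta> \<in> {0<..pi / 2}" for \<theta>
      using tan_half_pos[of \<theta>] tan_half_le_1[of \<theta>] that by (auto simp: norm_mult)
    have "continuous_on {0<..pi / 2} (\<lambda>\<theta>. T_primitive a X (\<i> * of_real (tan (\<theta> / 2))))"
      by (rule continuous_on_compose2[OF continuous_on_T_primitive[OF a X]])
        (use le_1 in \<open>auto intro!: continuous_on_mult continuous_on_of_real tan continuous_on_const\<close>)
    moreover have "continuous_on {0<..pi / 2} (\<lambda>\<theta>. ln (tan (\<theta> / 2)))"
      by (intro continuous_on_ln tan) (use tan_half_pos in force)
    ultimately show ?thesis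
      unfolding segment_primitive_def
      by (intro continuous_on_mult continuous_on_add continuous_on_exp continuous_on_of_real
          continuous_on_const continuous_on_power continuous_on_divide continuous_on_id) auto
  qed
  have "continuous (at x within {0..pi / 2}) segment_primitive" if x: "x \<in> {0..pi / 2}" for x
  proof (cases "x = 0")
    case False
    have "at x within {0..pi / 2} = at x within {0<..pi / 2}"
      by (rule at_within_nhd[where S = "{0<..}"]) (use x False in auto)
    with cont show ?thesis
      using x False by (simp add: continuous_on_eq_continuous_within)
  qed (use continuous_at_0_segment_primitive in simp)
  thus ?thesis
    by (simp add: continuous_on_eq_continuous_within)
qed

text \<open>Differentiating the exponential produces a multiple of the bracket, which by the
  differential equation of the series cancels the derivative of the series. Only the derivative of
  the power of \<theta> remains.\<close>

lemma has_vector_derivative_segment_primitive: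
  assumes \<theta>: "0 < \<theta>" "\<theta> < pi / 2"
  shows "(segment_primitive has_vector_derivative \<i> ^ a / fact (a - 1) *
            (of_real \<theta> ^ (a - 1) * exp (- X * of_real (ln (tan (\<theta> / 2)))))) (at \<theta>)"
proof -
  define s where "s = tan (\<theta> / 2)"
  define s' where "s' = inverse ((cos (\<theta> / 2))\<^sup>2) / 2"
  define e where "e = exp (- X * of_real (ln s))"
  define p where "p = (\<i> * of_real \<theta>) ^ a / (fact a :: complex)"
  have s: "s > 0" "s < 1"
    using \<theta> tan_half_pos[of \<theta>] tan_half_less_1[of \<theta>] by (auto simp: s_def)
  have tan: "((\<lambda>\<theta>. tan (\<theta> / 2)) has_real_derivative s') (at \<theta>)"
    unfolding s'_def using \<theta> by (auto intro!: derivative_eq_intros simp: cos_gt_zero_pi less_imp_neq[symmetric])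
  have ln: "((\<lambda>\<theta>. ln (tan (\<theta> / 2))) has_real_derivative s' / s) (at \<theta>)"
    using DERIV_chain2[OF DERIV_ln tan] s by (simp add: s_def field_simps)
  have "((\<lambda>z. exp (- X * z)) has_field_derivative - X * e) (at (of_real (ln (tan (\<theta> / 2)))))"
    by (auto intro!: derivative_eq_intros simp: e_def s_def)
  from field_vector_diff_chain_at[OF has_vector_derivative_of_real[OF ln] this]
  have E: "((\<lambda>\<theta>. exp (- X * of_real (ln (tan (\<theta> / 2))))) has_vector_derivative of_real (s' / s) * (- X * e)) (at \<theta>)"
    by (simp add: o_def)
  have "norm (\<i> * of_real s) < 1"
    using s by (simp add: norm_mult)
  then obtain H' where H': "(T_primitive a X has_field_derivative H') (at (\<i> * of_real s))"
    "\<i> * of_real s * H' = X * T_primitive a X (\<i> * of_real s) +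
       Ln ((1 + \<i> * of_real s) / (1 - \<i> * of_real s)) ^ a / fact a"
    using has_field_derivative_T_primitive[OF a X] by metis
  have H'_eq: "\<i> * of_real s * H' = X * T_primitive a X (\<i> * of_real s) + p"
    using H'(2) \<theta> by (simp add: s_def p_def Ln_cayley_tan)
  have "((\<lambda>\<theta>. \<i> * of_real (tan (\<theta> / 2))) has_vector_derivative \<i> * of_real s') (at \<theta>)"
    by (intro has_vector_derivative_mult_right has_vector_derivative_of_real tan)
  from field_vector_diff_chain_at[OF this, of "T_primitive a X" H'] H'(1)
  have H: "((\<lambda>\<theta>. T_primitive a X (\<i> * of_real (tan (\<theta> / 2)))) has_vector_derivative \<i> * of_real s' * H') (at \<theta>)"
    by (simp add: o_def s_def)
  have P: "((\<lambda>\<theta>. (\<i> * of_real \<theta>) ^ a / fact a) has_vector_derivative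
             \<i> ^ a * of_real \<theta> ^ (a - 1) / fact (a - 1)) (at \<theta>)"
  proof (rule has_vector_derivative_real_field)
    obtain d where d: "a = Suc d"
      using a by (cases a) auto
    have "((\<lambda>z. (\<i> * z) ^ a / fact a) has_field_derivative
             (of_nat a * (\<i> * (\<i> * of_real \<theta>) ^ (a - 1))) / fact a) (at (of_real \<theta>))"
      by (auto intro!: derivative_eq_intros simp: d simp del: power_Suc of_nat_Suc fact_Suc)
    also have "(of_nat a * (\<i> * (\<i> * of_real \<theta>) ^ (a - 1))) / fact a =
               \<i> ^ a * of_real \<theta> ^ (a - 1) / (fact (a - 1) :: complex)"
      by (simp add: d power_mult_distrib del: of_nat_Suc)
    finally show "((\<lambda>z. (\<i> * z) ^ a / fact a) has_field_derivative
             \<i> ^ a * of_real \<theta> ^ (a - 1) / fact (a - 1)) (at (of_real \<theta>))" .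
  qed
  have "(segment_primitive has_vector_derivative
          (e * (X * (\<i> * of_real s' * H') + \<i> ^ a * of_real \<theta> ^ (a - 1) / fact (a - 1)) +
           of_real (s' / s) * (- X * e) * (X * T_primitive a X (\<i> * of_real s) + p))) (at \<theta>)"
    using has_vector_derivative_mult[OF E has_vector_derivative_add[OF has_vector_derivative_mult_right[OF H, of X] P]]
    unfolding segment_primitive_def e_def p_def s_def by simp
  \<comment> \<open>The bracket equals \<open>\<i> * s * H'\<close>, whose factor \<open>s\<close>
    cancels the denominator.\<close>
  also have "of_real (s' / s) * (- X * e) * (X * T_primitive a X (\<i> * of_real s) + p) =
             - (e * (X * (\<i> * of_real s' * H')))"
    unfolding H'_eq [symmetric] using s by (simp add: field_simps)
  finally show ?thesis
    by (simp add: algebra_simps e_def s_def)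
qed

lemma has_integral_segment:
  "((\<lambda>\<theta>. \<i> ^ a / fact (a - 1) * (of_real \<theta> ^ (a - 1) * exp (- X * of_real (ln (tan (\<theta> / 2))))))
     has_integral (X * T_primitive a X \<i> + (\<i> * of_real pi / 2) ^ a / fact a)) {0..pi / 2}"
proof -
  have "((\<lambda>\<theta>. \<i> ^ a / fact (a - 1) * (of_real \<theta> ^ (a - 1) * exp (- X * of_real (ln (tan (\<theta> / 2))))))
     has_integral (segment_primitive (pi / 2) - segment_primitive 0)) {0..pi / 2}"
    by (intro fundamental_theorem_of_calculus_interior continuous_on_segment_primitive has_vector_derivative_segment_primitive) auto
  moreover have "segment_primitive 0 = 0"
    using a by (simp add: segment_primitive_def T_primitive_0)
  moreover have "segment_primitive (pi / 2) = X * T_primitive a X \<i> + (\<i> * of_real pi / 2) ^ a / fact a"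
    by (simp add: segment_primitive_def tan_45)
  ultimately show ?thesis
    by simp
qed

end

section \<open>The generating function\<close>

lemma has_sum_geometric:
  fixes Y :: "'a :: {real_normed_field, banach}"
  assumes "norm Y < 1" "n > 0"
  shows "((\<lambda>k. (Y / of_nat n) ^ (k + 1)) has_sum (Y / (of_nat n - Y))) UNIV"
proof -
  have "norm (Y / of_nat n) < 1"
    using assms by (simp add: norm_divide divide_less_eq)
  hence s: "(\<lambda>k. (Y / of_nat n) ^ k) sums (1 / (1 - Y / of_nat n))"
    "summable (\<lambda>k. norm ((Y / of_nat n) ^ k))"
    by (auto intro: geometric_sums simp: norm_power)
  have "(\<lambda>k. (Y / of_nat n) ^ (k + 1)) sums (Y / of_nat n * (1 / (1 - Y / of_nat n)))"
    using sums_mult[OF s(1), of "Y / of_nat n"] by simp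
  moreover have "Y / of_nat n * (1 / (1 - Y / of_nat n)) = Y / (of_nat n - Y)"
    using assms norm_less_1_neq_of_nat[of Y n] by (simp add: field_simps)
  moreover have "summable (\<lambda>k. norm ((Y / of_nat n) ^ (k + 1)))"
    by (rule summable_ignore_initial_segment[OF s(2)])
  ultimately show ?thesis
    by (metis norm_summable_imp_has_sum)
qed

text \<open>In the double series of \<open>T_coeff a n * (X / n) ^ (k + 1)\<close> the sums over
  \<open>k\<close> are geometric and the sums over \<open>n\<close> are T-values. Absolute
  convergence permits the exchange.\<close>

lemma T_value_generating_function:
  assumes a: "a > 0" and X: "norm X < 1"
  defines "v \<equiv> \<lambda>k. of_real (T_value (replicate (a - 1) 1 @ [k + 2])) * X ^ (k + 1)"
  shows "summable (\<lambda>k. norm (v k))" "(\<Sum>k. v k) = X * T_primitive a X 1"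
proof -
  define f where "f = (\<lambda>(n, k). of_real (T_coeff a n) * (X / of_nat n) ^ (k + 1))"
  \<comment> \<open>Rows of the absolute values: the same geometric series at \<open>norm X\<close>.
    The row \<open>n = 0\<close> is zero.\<close>
  have row: "((\<lambda>k. T_coeff a n * (norm X / real n) ^ (k + 1)) has_sum
               T_coeff a n * (norm X / (real n - norm X))) UNIV" for n
    using a X has_sum_cmult_right[OF has_sum_geometric[of "norm X" n], of "T_coeff a n"]
    by (cases "n = 0") auto
  have row': "((\<lambda>k. f (n, k)) has_sum of_real (T_coeff a n) * (X / (of_nat n - X))) UNIV" for n
    using a X has_sum_cmult_right[OF has_sum_geometric[of X n], of "of_real (T_coeff a n)"]
    by (cases "n = 0") (auto simp: f_def)
  have "summable (\<lambda>n. T_coeff a n / norm (real n - norm X) * norm X)"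
    using summable_T_coeff_div_minus[of a "norm X"] a X by (intro summable_mult2) simp
  also have "(\<lambda>n. T_coeff a n / norm (real n - norm X) * norm X) =
             (\<lambda>n. T_coeff a n * (norm X / (real n - norm X)))"
  proof
    fix n
    have "real n - norm X \<ge> 0" if "n > 0"
    proof -
      have "real n \<ge> 1"
        using that by simp
      with X show ?thesis
        by linarith
    qed
    thus "T_coeff a n / norm (real n - norm X) * norm X = T_coeff a n * (norm X / (real n - norm X))"
      using a by (cases "n = 0") auto
  qed
  finally have col: "(\<lambda>n. T_coeff a n * (norm X / (real n - norm X))) summable_on UNIV"
    by (rule summable_nonneg_imp_summable_on) (rule has_sum_nonneg[OF row], simp add: T_coeff_nonneg)
  have "(\<lambda>(n, k). T_coeff a n * (norm X / real n) ^ (k + 1)) summable_on UNIV \<times> UNIV"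
    by (rule summable_on_SigmaI[OF _ col]) (use row T_coeff_nonneg in auto)
  also have "(\<lambda>(n, k). T_coeff a n * (norm X / real n) ^ (k + 1)) = (\<lambda>p. norm (f p))"
    by (auto simp: f_def norm_mult norm_divide norm_power T_coeff_nonneg fun_eq_iff)
  finally have f: "(\<lambda>p. norm (f p)) summable_on UNIV \<times> UNIV" .
  have f': "(f has_sum infsum f (UNIV \<times> UNIV)) (UNIV \<times> UNIV)"
    by (rule has_sum_infsum[OF abs_summable_summable[OF f]])
  have swap: "bij_betw prod.swap (UNIV \<times> UNIV) (UNIV \<times> UNIV)"
    by (simp add: bij_swap)
  have column: "((\<lambda>n. f (n, k)) has_sum v k) UNIV" for k
  proof -
    have "((\<lambda>n. T_coeff a n / real n ^ (k + 1)) has_sum T_value (replicate (a - 1) 1 @ [k + 2])) UNIV"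
      using T_value_has_sum[of a "k + 1"] a by simp
    from has_sum_cmult_left[OF has_sum_of_real[OF this], of "X ^ (k + 1)"]
    show ?thesis
      by (simp add: f_def v_def power_divide)
  qed
  have "((\<lambda>n. of_real (T_coeff a n) * (X / (of_nat n - X))) has_sum infsum f (UNIV \<times> UNIV)) UNIV"
    by (rule has_sum_SigmaD[OF f' row'])
  hence rows: "(\<lambda>n. of_real (T_coeff a n) * (X / (of_nat n - X))) sums infsum f (UNIV \<times> UNIV)"
    by (rule has_sum_imp_sums)
  have "((\<lambda>p. f (prod.swap p)) has_sum infsum f (UNIV \<times> UNIV)) (UNIV \<times> UNIV)"
    using f' unfolding has_sum_reindex_bij_betw[OF swap] .
  hence v: "(v has_sum infsum f (UNIV \<times> UNIV)) UNIV"
    by (rule has_sum_SigmaD) (use column in simp)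
  hence "(\<lambda>k. norm (v k)) summable_on UNIV"
    by (metis has_sum_imp_summable summable_on_iff_abs_summable_on_complex)
  thus "summable (\<lambda>k. norm (v k))"
    by (rule summable_on_imp_summable)
  have "summable (\<lambda>n. fps_nth (T_primitive_fps a X) n * 1 ^ n)"
    by (rule summable_norm_cancel [OF summable_norm_T_primitive[OF a X]]) simp
  hence "(\<lambda>n. X * (fps_nth (T_primitive_fps a X) n * 1 ^ n)) sums (X * T_primitive a X 1)"
    unfolding eval_fps_def by (intro sums_mult summable_sums)
  hence "(\<lambda>n. of_real (T_coeff a n) * (X / (of_nat n - X))) sums (X * T_primitive a X 1)"
    by (simp add: mult.commute)
  with rows have "infsum f (UNIV \<times> UNIV) = X * T_primitive a X 1"
    by (rule sums_unique2)
  with has_sum_imp_sums[OF v] show "(\<Sum>k. v k) = X * T_primitive a X 1"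
    by (simp add: sums_iff)
qed

theorem theorem4:
  fixes a :: nat and X :: complex
  defines "L \<equiv> \<lambda>\<theta>::real. complex_of_real (ln (tan (\<theta> / 2)))"
  defines "F \<equiv> \<lambda>\<theta>::real. complex_of_real \<theta> ^ (a - 1) * exp (- X * L \<theta>)"
  defines "G \<equiv> \<lambda>\<theta>::real. 2 * X\<^sup>2 * exp (- \<i> * complex_of_real \<theta> * X) /
      (exp (- complex_of_real pi * \<i> * X) + 1) * (complex_of_real pi / 2 * \<i> - L \<theta>) ^ a"
  defines "S \<equiv> \<lambda>b::nat. \<Sum>k=1..b-1.
      (1 - 2 ^ (b - k)) * complex_of_real (bernoulli (b - k)) / fact (b - k)
      * (- complex_of_real pi * \<i>) ^ (b - k - 1)
      * complex_of_real (T_value (replicate (a - 1) 1 @ [k + 1])) * X ^ b"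
  assumes "a \<ge> 1" and "norm X < 1"
  shows "F integrable_on {0..pi/2} \<and>
    G integrable_on {0..pi/2} \<and>
    summable (\<lambda>n. S (n + 2)) \<and>
    2 * (\<Sum>n. S (n + 2)) =
      \<i> ^ a / fact (a - 1) * X * sec (complex_of_real pi * X / 2) * integral {0..pi/2} F
      - \<i> / fact a * integral {0..pi/2} G
      - (\<i> * complex_of_real pi / 2) ^ a / fact a * X * sec (complex_of_real pi * X / 2)"
proof -
  have a: "a > 0"
    using \<open>a \<ge> 1\<close> by simp
  note X = \<open>norm X < 1\<close>
  define w where "w = - complex_of_real pi * \<i> * X"
  \<comment> \<open>The Bernoulli factor is shifted by one because its coefficient at 0 is
    \<open>1 - 2 ^ 0 = 0\<close>.\<close>
  define u where "u = (\<lambda>j. fps_nth bernoulli_diff_fps (Suc j) * (- complex_of_real pi * \<i>) ^ j * X ^ Suc j)"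
  define v where "v = (\<lambda>k. complex_of_real (T_value (replicate (a - 1) 1 @ [k + 2])) * X ^ (k + 1))"
  have w: "norm w < pi"
    using X by (simp add: w_def norm_mult)
  hence D: "exp w + 1 \<noteq> 0"
    by (rule exp_plus_1_nonzero)
  \<comment> \<open>One factor \<open>- pi * \<i>\<close> is missing from the full power of
    \<open>w\<close>, hence the quotient.\<close>
  have u_eq: "u = (\<lambda>j. fps_nth bernoulli_diff_fps (Suc j) * w ^ Suc j / (- complex_of_real pi * \<i>))"
  proof -
    have "x * q ^ j * X ^ Suc j = x * (q * X) ^ Suc j / q" if "q \<noteq> 0" for x q :: complex and j
      using that by (simp add: power_mult_distrib field_simps)
    moreover have "- complex_of_real pi * \<i> \<noteq> 0"
      by simp
    ultimately show ?thesis
      unfolding u_def w_def by (intro ext)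
  qed
  have "summable (\<lambda>j. norm (fps_nth bernoulli_diff_fps (Suc j) * w ^ Suc j))"
    using summable_bernoulli_diff[OF w] by (rule summable_Suc_iff[THEN iffD2])
  hence u1: "summable (\<lambda>j. norm (u j))"
    unfolding u_eq norm_divide by (rule summable_divide)
  have "(\<lambda>j. fps_nth bernoulli_diff_fps (Suc j) * w ^ Suc j) sums (w / (exp w + 1))"
    using eval_bernoulli_diff[OF w] by (subst sums_Suc_iff) (simp add: bernoulli_diff_fps_def)
  hence "u sums (w / (exp w + 1) / (- complex_of_real pi * \<i>))"
    unfolding u_eq by (rule sums_divide)
  hence u2: "(\<Sum>j. u j) = X / (exp w + 1)"
    by (simp add: sums_iff w_def)
  have v: "summable (\<lambda>k. norm (v k))" "(\<Sum>k. v k) = X * T_primitive a X 1"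
    unfolding v_def by (fact T_value_generating_function[OF a X])+
  \<comment> \<open>With \<open>b = n + 2\<close> and \<open>k = i + 1\<close>, the inner sum is a
    Cauchy product term: the exponent \<open>n + 2\<close> splits as
    \<open>(i + 1) + (n - i + 1)\<close>.\<close>
  have S_eq: "S (n + 2) = (\<Sum>i\<le>n. v i * u (n - i))" for n
  proof -
    have "S (n + 2) = (\<Sum>i<Suc n. (1 - 2 ^ (n + 2 - Suc i)) * complex_of_real (bernoulli (n + 2 - Suc i)) / fact (n + 2 - Suc i)
      * (- complex_of_real pi * \<i>) ^ (n + 2 - Suc i - 1)
      * complex_of_real (T_value (replicate (a - 1) 1 @ [Suc i + 1])) * X ^ (n + 2))"
      by (simp add: S_def sum.atLeast1_atMost_eq del: sum.lessThan_Suc)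
    also have "\<dots> = (\<Sum>i\<le>n. v i * u (n - i))"
      unfolding lessThan_Suc_atMost
    proof (rule sum.cong [OF refl])
      fix i assume "i \<in> {..n}"
      then obtain m where n: "n = i + m"
        by (auto simp: le_iff_add)
      have [simp]: "n + 2 - Suc i = Suc m" "n - i = m" "n + 2 = (i + 1) + Suc m"
        by (simp_all add: n)
      show "(1 - 2 ^ (n + 2 - Suc i)) * complex_of_real (bernoulli (n + 2 - Suc i)) / fact (n + 2 - Suc i)
          * (- complex_of_real pi * \<i>) ^ (n + 2 - Suc i - 1)
          * complex_of_real (T_value (replicate (a - 1) 1 @ [Suc i + 1])) * X ^ (n + 2) = v i * u (n - i)"
        unfolding u_def v_def bernoulli_diff_fps_def
        by (simp only: \<open>n + 2 - Suc i = Suc m\<close> \<open>n - i = m\<close> \<open>n + 2 = (i + 1) + Suc m\<close> power_add fps_nth_Abs_fps)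
          (simp del: power_Suc fact_Suc)
    qed
    finally show ?thesis .
  qed
  have S: "(\<lambda>n. S (n + 2)) sums (X * T_primitive a X 1 * (X / (exp w + 1)))"
    using Cauchy_product_sums[OF v(1) u1] by (simp only: S_eq v(2) u2)

  define P where "P = (\<i> * complex_of_real pi / 2) ^ a / fact a"
  define c where "c = \<i> ^ a / (fact (a - 1) :: complex)"
  have c: "c \<noteq> 0"
    by (simp add: c_def)
  have "((\<lambda>\<theta>. c * F \<theta>) has_integral (X * T_primitive a X \<i> + P)) {0..pi / 2}"
    using has_integral_segment[OF a X] by (simp only: c_def F_def L_def P_def)
  from has_integral_mult_right[OF this, of "1 / c"]
  have F: "(F has_integral (X * T_primitive a X \<i> + P) / c) {0..pi / 2}"
    using c by simp

  \<comment> \<open>This is the exponential at the end point \<open>\<i>\<close> of the arc; its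
    square is \<open>exp w\<close>, so the secant is \<open>2 / (e + 1 / e)\<close>.\<close>
  define e where "e = exp (w / 2)"
  define d where "d = 2 * X\<^sup>2 / (exp w + 1)"
  have "((\<lambda>\<theta>. \<i> * exp (- \<i> * of_real \<theta> * X) * (of_real pi / 2 * \<i> - L \<theta>) ^ a / fact a)
      has_integral (e * T_primitive a X \<i> - T_primitive a X 1)) {0..pi / 2}"
    using has_integral_arc[OF a X] by (simp add: L_def e_def w_def mult_ac)
  from has_integral_mult_right[OF this, of "d * fact a / \<i>"]
  have G: "(G has_integral (d * fact a / \<i>) * (e * T_primitive a X \<i> - T_primitive a X 1)) {0..pi / 2}"
    by (simp add: G_def d_def w_def mult_ac)

  have e2: "exp w = e * e"
    by (simp add: e_def flip: exp_add)
  have "e \<noteq> 0"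
    by (simp add: e_def)
  have sec: "sec (complex_of_real pi * X / 2) = 2 * e / (exp w + 1)"
  proof -
    have "\<i> * (complex_of_real pi * X / 2) = - (w / 2)"
      by (simp add: w_def)
    hence "cos (complex_of_real pi * X / 2) = (inverse e + e) / 2"
      by (simp add: cos_exp_eq e_def exp_minus)
    hence "sec (complex_of_real pi * X / 2) = 1 / ((inverse e + e) / 2)"
      by (simp only: sec_def)
    also have "inverse e + e = (exp w + 1) / e"
      using \<open>e \<noteq> 0\<close> by (simp add: e2 field_simps)
    also have "1 / ((exp w + 1) / e / 2) = 2 * e / (exp w + 1)"
      by simp
    finally show ?thesis .
  qed
  have int_F: "c * integral {0..pi / 2} F = X * T_primitive a X \<i> + P"
    using c by (simp add: integral_unique[OF F])
  have int_G: "\<i> / fact a * integral {0..pi / 2} G = d * (e * T_primitive a X \<i> - T_primitive a X 1)"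
    by (simp add: integral_unique[OF G])
  \<comment> \<open>The values at \<open>\<i>\<close> from the two integrals cancel, as do both
    terms with \<open>P\<close>; only the value at 1 is left.\<close>
  have "2 * (X * T_primitive a X 1 * (X / (exp w + 1))) =
      X * (2 * e / (exp w + 1)) * (X * T_primitive a X \<i> + P) - d * (e * T_primitive a X \<i> - T_primitive a X 1)
      - P * X * (2 * e / (exp w + 1))"
    by (simp add: d_def divide_inverse algebra_simps power2_eq_square)
  hence "2 * (\<Sum>n. S (n + 2)) =
      X * sec (complex_of_real pi * X / 2) * (c * integral {0..pi / 2} F)
      - \<i> / fact a * integral {0..pi / 2} G - P * X * sec (complex_of_real pi * X / 2)"
    unfolding sec sums_unique[OF S, symmetric] int_F int_G .
  with F G S show ?thesis
    by (auto simp: c_def P_def integrable_on_def summable_def mult_ac)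
qed

end
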